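(* $M_i$ is a perfect stable matching of $I_T$ if and only if $M_i\mathcal{O}_I$ is a reduced stable partition of $I$, where $\mathcal{O}_I$ are the invariant odd cycles of $I$.
   Context: An SR (Stable Roommates) instance $I=(A,\succ)$ consists of an even number $n$ of agents, each with a strict complete preference ranking over all other agents (and ranking itself last). A stable partition is a permutation $\Pi$ of $A$ such that (T1) every agent weakly prefers its successor $\Pi(a_i)$ to its predecessor $\Pi^{-1}(a_i)$, and (T2) there are no two distinct agents $a_i,a_j$ with $a_j \succ_i \Pi^{-1}(a_i)$ and $a_i \succ_j \Pi^{-1}(a_j)$. It is reduced if all its cycles have length 2 or odd length. The odd cycles $\mathcal{O}_I$ are the same in all stable partitions of $I$. Let $I_E=(A',\succ')$ with $A'=A\setminus A(\mathcal{O}_I)$ and $\succ'$ the restriction of $\succ$ to $A'$. The instance $I_T=(A',\succ'')$ (possibly with incomplete lists) is obtained from $I_E$ by making each pair $\{a_i,a_j\}\subseteq A'$ mutually unacceptable whenever there is an agent $a_r\in A(\mathcal{O}_I)$ with $a_i \succ_r \mathcal{O}_I^{-1}(a_r)$ and $a_r \succ_i a_j$. A collection of transpositions is identified with the matching of its pairs. *)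

theory Defs
  imports "HOL-Combinatorics.Combinatorics"
begin

text \<open>
  Preferences are a family \<open>P\<close> of strict relations: \<open>(x, y) \<in> P i\<close> means that agent \<open>i\<close> strictly
  prefers \<open>x\<close> to \<open>y\<close>.  Every agent ranks itself last, so \<open>(j, i) \<in> P i\<close> says that \<open>j\<close> is
  acceptable to \<open>i\<close>.  With incomplete lists, the unacceptable agents do not occur in \<open>P i\<close> at all.
\<close>

definition sr_instance :: "'a set \<Rightarrow> ('a \<Rightarrow> 'a rel) \<Rightarrow> bool" where
  "sr_instance A P \<longleftrightarrow> finite A \<and> even (card A) \<and>
     (\<forall>i\<in>A. P i \<subseteq> A \<times> A \<and> strict_linear_order_on A (P i) \<and> (\<forall>j\<in>A - {i}. (j, i) \<in> P i))"

definition acceptable :: "('a \<Rightarrow> 'a rel) \<Rightarrow> 'a \<Rightarrow> 'a \<Rightarrow> bool" where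
  "acceptable P i j \<longleftrightarrow> (j, i) \<in> P i"

definition stable_partition :: "'a set \<Rightarrow> ('a \<Rightarrow> 'a rel) \<Rightarrow> ('a \<Rightarrow> 'a) \<Rightarrow> bool" where
  "stable_partition A P \<pi> \<longleftrightarrow> \<pi> permutes A \<and>
     (\<forall>i\<in>A. \<pi> i = inv \<pi> i \<or> (\<pi> i, inv \<pi> i) \<in> P i) \<and>
     \<not> (\<exists>i\<in>A. \<exists>j\<in>A. i \<noteq> j \<and> (j, inv \<pi> i) \<in> P i \<and> (i, inv \<pi> j) \<in> P j)"

definition reduced :: "'a set \<Rightarrow> ('a \<Rightarrow> 'a) \<Rightarrow> bool" where
  "reduced A \<pi> \<longleftrightarrow> (\<forall>i\<in>A. card (orbit \<pi> i) = 2 \<or> odd (card (orbit \<pi> i)))"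

text \<open>
  The odd cycles of \<open>\<pi>\<close> are given by the set of agents lying on them and by the permutation that
  acts as \<open>\<pi>\<close> on this set and as the identity elsewhere.  The set is recorded separately because
  an odd cycle may be a fixed point.
\<close>

definition odd_agents :: "'a set \<Rightarrow> ('a \<Rightarrow> 'a) \<Rightarrow> 'a set" where
  "odd_agents A \<pi> = {i \<in> A. odd (card (orbit \<pi> i))}"

definition odd_cycles :: "'a set \<Rightarrow> ('a \<Rightarrow> 'a) \<Rightarrow> 'a \<Rightarrow> 'a" where
  "odd_cycles A \<pi> = perm_restrict \<pi> (odd_agents A \<pi>)"

definition E_prefs :: "('a \<Rightarrow> 'a rel) \<Rightarrow> 'a set \<Rightarrow> 'a \<Rightarrow> 'a rel" where
  "E_prefs P A' i = Restr (P i) A'"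

text \<open>
  \<open>C\<close> is the set of agents on odd cycles and \<open>\<omega>\<close> the permutation formed by these cycles.  An
  unordered pair is deleted if the condition holds for either of its two orderings.
\<close>

definition T_deletes :: "('a \<Rightarrow> 'a rel) \<Rightarrow> 'a set \<Rightarrow> ('a \<Rightarrow> 'a) \<Rightarrow> 'a \<Rightarrow> 'a \<Rightarrow> bool" where
  "T_deletes P C \<omega> i j \<longleftrightarrow> (\<exists>r\<in>C. (i, inv \<omega> r) \<in> P r \<and> (r, j) \<in> P i)"

definition T_unacceptable :: "('a \<Rightarrow> 'a rel) \<Rightarrow> 'a set \<Rightarrow> ('a \<Rightarrow> 'a) \<Rightarrow> 'a \<Rightarrow> 'a \<Rightarrow> bool" where
  "T_unacceptable P C \<omega> i j \<longleftrightarrow> i \<noteq> j \<and> (T_deletes P C \<omega> i j \<or> T_deletes P C \<omega> j i)"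

definition T_prefs :: "'a set \<Rightarrow> ('a \<Rightarrow> 'a rel) \<Rightarrow> 'a set \<Rightarrow> ('a \<Rightarrow> 'a) \<Rightarrow> 'a \<Rightarrow> 'a rel" where
  "T_prefs A P C \<omega> i = Restr (E_prefs P (A - C) i) {j. \<not> T_unacceptable P C \<omega> i j}"

definition disjoint_pairs :: "'a set \<Rightarrow> 'a set set \<Rightarrow> bool" where
  "disjoint_pairs A M \<longleftrightarrow> (\<forall>e\<in>M. e \<subseteq> A \<and> card e = 2) \<and> pairwise disjnt M"

text \<open>
  For disjoint pairs, \<open>partner M\<close> is the product of the corresponding transpositions; unmatched
  elements are fixed.
\<close>

definition partner :: "'a set set \<Rightarrow> 'a \<Rightarrow> 'a" where
  "partner M i = (if \<exists>j. j \<noteq> i \<and> {i, j} \<in> M then THE j. j \<noteq> i \<and> {i, j} \<in> M else i)"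

definition matching :: "'a set \<Rightarrow> ('a \<Rightarrow> 'a rel) \<Rightarrow> 'a set set \<Rightarrow> bool" where
  "matching A P M \<longleftrightarrow> disjoint_pairs A M \<and>
     (\<forall>i j. i \<noteq> j \<and> {i, j} \<in> M \<longrightarrow> acceptable P i j \<and> acceptable P j i)"

text \<open>
  An unmatched agent \<open>i\<close> has \<open>partner M i = i\<close>, which it ranks below every acceptable agent.
\<close>

definition blocking_pair :: "'a set \<Rightarrow> ('a \<Rightarrow> 'a rel) \<Rightarrow> 'a set set \<Rightarrow> 'a \<Rightarrow> 'a \<Rightarrow> bool" where
  "blocking_pair A P M i j \<longleftrightarrow> i \<in> A \<and> j \<in> A \<and> i \<noteq> j \<and> acceptable P i j \<and> acceptable P j i \<and>
     (j, partner M i) \<in> P i \<and> (i, partner M j) \<in> P j"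

definition stable_matching :: "'a set \<Rightarrow> ('a \<Rightarrow> 'a rel) \<Rightarrow> 'a set set \<Rightarrow> bool" where
  "stable_matching A P M \<longleftrightarrow> matching A P M \<and> \<not> (\<exists>i j. blocking_pair A P M i j)"

definition perfect_stable_matching :: "'a set \<Rightarrow> ('a \<Rightarrow> 'a rel) \<Rightarrow> 'a set set \<Rightarrow> bool" where
  "perfect_stable_matching A P M \<longleftrightarrow> stable_matching A P M \<and> \<Union>M = A"

end

theory Submission
  imports Defs
begin

text \<open>
  The odd cycles are invariant (Tan): a stable partition with weight 1/2 on every edge
  \<open>{i, \<pi> i}\<close> is a fractional stable matching, and double counting two of them \<open>\<pi>\<close> and \<open>\<sigma>\<close>
  against each other shows that the stability constraint of \<open>\<sigma>\<close> is tight on each edge of \<open>\<pi>\<close>.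
  Hence, unless \<open>\<sigma>\<close> agrees with \<open>\<pi>\<close> along a cycle of \<open>\<pi>\<close> of length at least 3, the agents on
  that cycle alternate between having both \<open>\<sigma>\<close>-neighbours at least as good as their successor
  and having both worse, so its length is even.

  Given the invariance, the pairs removed from the preferences of \<open>I_T\<close> are those that would leave
  an agent outside the odd cycles blocking with an agent on them.
\<close>

subsection \<open>Invariance of the odd cycles\<close>

lemma sr_instance_asym:
  assumes "sr_instance A P" "i \<in> A" "(x, y) \<in> P i"
  shows "(y, x) \<notin> P i" "x \<noteq> y"
  using assms unfolding sr_instance_def strict_linear_order_on_def irrefl_def trans_def by blast+

lemma sr_instance_trans:
  assumes "sr_instance A P" "i \<in> A" "(x, y) \<in> P i" "(y, z) \<in> P i"
  shows "(x, z) \<in> P i"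
  using assms unfolding sr_instance_def strict_linear_order_on_def trans_def by blast

lemma sr_instance_total:
  assumes "sr_instance A P" "i \<in> A" "x \<in> A" "y \<in> A" "x \<noteq> y"
  shows "(x, y) \<in> P i \<or> (y, x) \<in> P i"
  using assms unfolding sr_instance_def strict_linear_order_on_def total_on_def by blast

lemma stable_partition_permutes: "stable_partition A P \<pi> \<Longrightarrow> \<pi> permutes A"
  by (simp add: stable_partition_def)

lemma stable_partition_mem:
  assumes "stable_partition A P \<pi>" "i \<in> A"
  shows "\<pi> i \<in> A" "inv \<pi> i \<in> A" "inv \<pi> (\<pi> i) = i" "\<pi> (inv \<pi> i) = i"
  using assms stable_partition_permutes[OF assms(1)]
  by (auto simp: permutes_in_image permutes_inv permutes_inverses)

lemma stable_partition_succ: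
  assumes "stable_partition A P \<pi>" "i \<in> A"
  shows "\<pi> i = inv \<pi> i \<or> (\<pi> i, inv \<pi> i) \<in> P i"
  using assms by (auto simp: stable_partition_def)

lemma stable_partition_no_block:
  assumes "stable_partition A P \<pi>" "i \<in> A" "j \<in> A" "i \<noteq> j" "(j, inv \<pi> i) \<in> P i"
  shows "(i, inv \<pi> j) \<notin> P j"
  using assms by (auto simp: stable_partition_def)

section \<open>Fractional stable matchings and complementary slackness\<close>

definition weakly_prefers :: "('a \<Rightarrow> 'a rel) \<Rightarrow> 'a \<Rightarrow> 'a \<Rightarrow> 'a \<Rightarrow> bool" where
  "weakly_prefers P i x y \<longleftrightarrow> x = y \<or> (x, y) \<in> P i"

text \<open>Successor and predecessor count separately, so a transposition or a fixed point counts
  twice and each agent has total weight 2.\<close>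

definition upper_count :: "('a \<Rightarrow> 'a rel) \<Rightarrow> ('a \<Rightarrow> 'a) \<Rightarrow> 'a \<Rightarrow> 'a \<Rightarrow> int" where
  "upper_count P \<sigma> i x =
     of_bool (weakly_prefers P i (\<sigma> i) x) + of_bool (weakly_prefers P i (inv \<sigma> i) x)"

definition multiplicity_at :: "('a \<Rightarrow> 'a) \<Rightarrow> 'a \<Rightarrow> 'a \<Rightarrow> int" where
  "multiplicity_at \<sigma> i j = of_bool (\<sigma> i = j) + of_bool (inv \<sigma> i = j)"

text \<open>Inclusion-exclusion: an edge between \<open>i\<close> and \<open>j\<close> occurs in the
  counts at both ends and is therefore subtracted once.\<close>

definition edge_value :: "('a \<Rightarrow> 'a rel) \<Rightarrow> ('a \<Rightarrow> 'a) \<Rightarrow> 'a \<Rightarrow> 'a \<Rightarrow> int" where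
  "edge_value P \<sigma> i j = upper_count P \<sigma> i j + upper_count P \<sigma> j i - multiplicity_at \<sigma> i j"

text \<open>
  Giving every edge \<open>{i, \<sigma> i}\<close> weight 1/2 turns a stable partition into a point of the fractional
  stable matching polytope; this is its defining inequality, multiplied by 2.
\<close>

lemma edge_value_ge_2:
  assumes sr: "sr_instance A P" and st: "stable_partition A P \<sigma>" and ij: "i \<in> A" "j \<in> A"
  shows "2 \<le> edge_value P \<sigma> i j"
proof (cases "i = j")
  case True
  \<comment> \<open>Every agent ranks itself last, so both counts are 2 and the multiplicity takes
    away at most 2.\<close>
  have "weakly_prefers P i x i" if "x \<in> A" for x
    using sr ij that by (auto simp: weakly_prefers_def sr_instance_def)
  with True stable_partition_mem[OF st] ij show ?thesis
    by (simp add: edge_value_def upper_count_def multiplicity_at_def)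
next
  case False
  have full: "upper_count P \<sigma> x y = 2"
    if "x \<in> A" "weakly_prefers P x (inv \<sigma> x) y" for x y
  proof -
    have "weakly_prefers P x (\<sigma> x) y"
      using stable_partition_succ[OF st \<open>x \<in> A\<close>] that sr_instance_trans[OF sr \<open>x \<in> A\<close>]
      unfolding weakly_prefers_def by metis
    with that show ?thesis by (simp add: upper_count_def)
  qed
  have mult: "multiplicity_at \<sigma> x y \<le> upper_count P \<sigma> x y" for x y
    by (auto simp: multiplicity_at_def upper_count_def weakly_prefers_def)
  have sym: "multiplicity_at \<sigma> i j = multiplicity_at \<sigma> j i"
    using stable_partition_permutes[OF st]
    by (auto simp: multiplicity_at_def permutes_inv_eq of_bool_def)
  \<comment> \<open>By stability, one end finds its predecessor at least as good as the other end.
    It counts 2 by \<open>full\<close>, and the count at the other end covers the multiplicity by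
    \<open>mult\<close>.\<close>
  have "weakly_prefers P i (inv \<sigma> i) j \<or> weakly_prefers P j (inv \<sigma> j) i"
    using stable_partition_no_block[OF st ij False] sr_instance_total[OF sr] ij
      stable_partition_mem[OF st]
    unfolding weakly_prefers_def by metis
  with full[OF ij(1), of j] full[OF ij(2), of i] mult[of j i] mult[of i j] sym show ?thesis
    by (auto simp: edge_value_def)
qed

text \<open>After reindexing, each agent compares each of its two neighbours under
  \<open>\<pi>\<close> with each of its two under \<open>\<sigma>\<close>, in both directions. Each
  of these four comparisons yields 1, and one more for a tie; the ties cancel the
  multiplicities.\<close>

lemma sum_edge_value:
  assumes sr: "sr_instance A P"
    and sp: "stable_partition A P \<pi>" and ss: "stable_partition A P \<sigma>"
  shows "(\<Sum>i\<in>A. edge_value P \<sigma> i (\<pi> i)) + (\<Sum>i\<in>A. edge_value P \<pi> i (\<sigma> i)) = 4 * int (card A)"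
proof -
  have pp: "\<pi> permutes A" and ps: "\<sigma> permutes A"
    using sp ss by (simp_all add: stable_partition_permutes)
  have reindex: "(\<Sum>i\<in>A. upper_count P g (f i) i) = (\<Sum>i\<in>A. upper_count P g i (inv f i))"
    if "f permutes A" for f g
    using sum.permute[OF that, of "\<lambda>i. upper_count P g i (inv f i)"] permutes_inverses[OF that]
    by (simp add: o_def)
  \<comment> \<open>Shifting along \<open>\<pi>\<close> turns ties between successors into ties
    between predecessors.\<close>
  have m1: "(\<Sum>i\<in>A. of_bool (\<pi> i = \<sigma> i)) = (\<Sum>i\<in>A. of_bool (inv \<pi> i = inv \<sigma> i) :: int)"
    using sum.permute[OF pp, of "\<lambda>i. of_bool (inv \<pi> i = inv \<sigma> i) :: int"]
      permutes_inverses[OF pp] permutes_inv_eq[OF ps]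
    by (simp add: o_def eq_commute)
  have m2: "(\<Sum>i\<in>A. of_bool (inv \<sigma> i = \<pi> i)) = (\<Sum>i\<in>A. of_bool (inv \<pi> i = \<sigma> i) :: int)"
    using sum.permute[OF pp, of "\<lambda>i. of_bool (inv \<pi> i = \<sigma> i) :: int"]
      permutes_inverses[OF pp] permutes_inv_eq[OF ps]
    by (simp add: o_def eq_commute)
  have pair: "of_bool (weakly_prefers P i x y) + of_bool (weakly_prefers P i y x) =
      1 + (of_bool (x = y) :: int)" if "i \<in> A" "x \<in> A" "y \<in> A" for i x y
    using sr_instance_total[OF sr that] sr_instance_asym[OF sr \<open>i \<in> A\<close>]
    by (auto simp: weakly_prefers_def)
  have four: "upper_count P \<sigma> i (\<pi> i) + upper_count P \<sigma> i (inv \<pi> i)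
      + upper_count P \<pi> i (\<sigma> i) + upper_count P \<pi> i (inv \<sigma> i)
    = 4 + (of_bool (\<pi> i = \<sigma> i) + of_bool (inv \<pi> i = inv \<sigma> i)
         + of_bool (inv \<sigma> i = \<pi> i) + of_bool (inv \<pi> i = \<sigma> i))" (is "?l i = ?r i")
    if i: "i \<in> A" for i
    using pair[OF i, of "\<pi> i" "\<sigma> i"] pair[OF i, of "inv \<pi> i" "inv \<sigma> i"]
      pair[OF i, of "\<pi> i" "inv \<sigma> i"] pair[OF i, of "inv \<pi> i" "\<sigma> i"]
      stable_partition_mem[OF sp i] stable_partition_mem[OF ss i]
    by (simp add: upper_count_def eq_commute)
  have "(\<Sum>i\<in>A. ?l i) = (\<Sum>i\<in>A. ?r i)"
    by (rule sum.cong) (use four in auto)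
  moreover have "of_bool (\<sigma> i = \<pi> i) = (of_bool (\<pi> i = \<sigma> i) :: int)" for i
    by auto
  ultimately show ?thesis
    using m1 m2
    by (simp add: edge_value_def multiplicity_at_def sum.distrib sum_subtractf reindex[OF pp]
        reindex[OF ps])
qed

text \<open>Complementary slackness: every term of the previous sum is at its minimum.\<close>

lemma edge_value_eq_2:
  assumes sr: "sr_instance A P"
    and sp: "stable_partition A P \<pi>" and ss: "stable_partition A P \<sigma>" and i: "i \<in> A"
  shows "edge_value P \<sigma> i (\<pi> i) = 2"
proof -
  have ge: "2 \<le> edge_value P \<sigma> x (\<pi> x)" "2 \<le> edge_value P \<pi> x (\<sigma> x)" if "x \<in> A" for x
    using edge_value_ge_2[OF sr] sp ss that stable_partition_mem by metis+
  have "finite A" using sr by (simp add: sr_instance_def)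
  have "(\<Sum>x\<in>A. 2) = (\<Sum>x\<in>A. edge_value P \<sigma> x (\<pi> x))"
    using sum_edge_value[OF sr sp ss]
      sum_mono[of A "\<lambda>x. 2" "\<lambda>x. edge_value P \<sigma> x (\<pi> x)"]
      sum_mono[of A "\<lambda>x. 2" "\<lambda>x. edge_value P \<pi> x (\<sigma> x)"] ge by simp
  from sum_mono_inv[OF this ge(1) i \<open>finite A\<close>] show ?thesis by simp
qed

text \<open>On an edge of \<open>\<pi>\<close> not shared with \<open>\<sigma>\<close> the
  multiplicity is 0, so tightness leaves a total of 2 for both ends. Stability of
  \<open>\<sigma>\<close> gives 2 to one end, hence 0 to the other: \<open>low\<close> is count 0 at
  \<open>i\<close>, \<open>high\<close> is count 2.\<close>

lemma stable_partition_compare: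
  assumes sr: "sr_instance A P"
    and sp: "stable_partition A P \<pi>" and ss: "stable_partition A P \<sigma>" and i: "i \<in> A"
  obtains (same) "\<sigma> i = \<pi> i"
  | (reverse) "inv \<sigma> i = \<pi> i"
  | (low) "(\<pi> i, \<sigma> i) \<in> P i" "(inv \<sigma> (\<pi> i), i) \<in> P (\<pi> i)"
  | (high) "(inv \<sigma> i, \<pi> i) \<in> P i" "(i, \<sigma> (\<pi> i)) \<in> P (\<pi> i)"
proof (cases "\<sigma> i = \<pi> i \<or> inv \<sigma> i = \<pi> i")
  case True
  then show ?thesis using that by blast
next
  case False
  define j where "j = \<pi> i"
  note mi = stable_partition_mem[OF sp i] stable_partition_mem[OF ss i]
  have j: "j \<in> A" using mi by (simp add: j_def)
  note mj = stable_partition_mem[OF ss j]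
  have ne: "\<sigma> i \<noteq> j" "inv \<sigma> i \<noteq> j" using False by (auto simp: j_def)
  have ne': "\<sigma> j \<noteq> i" "inv \<sigma> j \<noteq> i"
    using ne permutes_inv_eq[OF stable_partition_permutes[OF ss]] by metis+
  have total: "upper_count P \<sigma> i j + upper_count P \<sigma> j i = 2"
    using edge_value_eq_2[OF sr sp ss i] ne
    by (simp add: edge_value_def multiplicity_at_def j_def)
  have counts:
    "upper_count P \<sigma> i j = of_bool ((\<sigma> i, j) \<in> P i) + of_bool ((inv \<sigma> i, j) \<in> P i)"
    "upper_count P \<sigma> j i = of_bool ((\<sigma> j, i) \<in> P j) + of_bool ((inv \<sigma> j, i) \<in> P j)"
    using ne ne' by (simp_all add: upper_count_def weakly_prefers_def)
  \<comment> \<open>A fixed point of \<open>\<pi>\<close> moved by \<open>\<sigma>\<close> would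
    count 2 at both ends, a total of 4.\<close>
  have "i \<noteq> j"
  proof
    assume "i = j"
    then have "(\<sigma> i, i) \<in> P i" "(inv \<sigma> i, i) \<in> P i"
      using sr i ne mi by (auto simp: sr_instance_def)
    with total counts \<open>i = j\<close> show False by simp
  qed
  have mono: "(\<sigma> i, j) \<in> P i" if "(inv \<sigma> i, j) \<in> P i"
    using stable_partition_succ[OF ss i] that sr_instance_trans[OF sr i] by metis
  have mono': "(\<sigma> j, i) \<in> P j" if "(inv \<sigma> j, i) \<in> P j"
    using stable_partition_succ[OF ss j] that sr_instance_trans[OF sr j] by metis
  have "(inv \<sigma> i, j) \<in> P i \<or> (inv \<sigma> j, i) \<in> P j"
    using stable_partition_no_block[OF ss i j \<open>i \<noteq> j\<close>] sr_instance_total[OF sr] i j mi mj ne ne'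
    by metis
  then consider "(inv \<sigma> i, j) \<in> P i" "(\<sigma> j, i) \<notin> P j"
    | "(inv \<sigma> j, i) \<in> P j" "(\<sigma> i, j) \<notin> P i"
    using total counts mono mono' by (auto simp: of_bool_def split: if_splits)
  then show ?thesis
  proof cases
    case 1
    with high show ?thesis
      using sr_instance_total[OF sr j i mj(1)] ne' by (auto simp: j_def)
  next
    case 2
    with low show ?thesis
      using sr_instance_total[OF sr i j mi(5)] ne by (auto simp: j_def)
  qed
qed

section \<open>Alternation along a cycle\<close>

text \<open>For stable \<open>\<sigma>\<close> the predecessor is the worse and the successor the
  better neighbour, so \<open>above\<close> and \<open>below\<close> each bound both neighbours
  through one.\<close>

definition above :: "('a \<Rightarrow> 'a rel) \<Rightarrow> ('a \<Rightarrow> 'a) \<Rightarrow> ('a \<Rightarrow> 'a) \<Rightarrow> 'a \<Rightarrow> bool" where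
  "above P \<pi> \<sigma> i \<longleftrightarrow> weakly_prefers P i (inv \<sigma> i) (\<pi> i)"

definition below :: "('a \<Rightarrow> 'a rel) \<Rightarrow> ('a \<Rightarrow> 'a) \<Rightarrow> ('a \<Rightarrow> 'a) \<Rightarrow> 'a \<Rightarrow> bool" where
  "below P \<pi> \<sigma> i \<longleftrightarrow> (\<pi> i, \<sigma> i) \<in> P i"

lemma not_above_below:
  assumes sr: "sr_instance A P" and ss: "stable_partition A P \<sigma>" and i: "i \<in> A"
    and "above P \<pi> \<sigma> i" "below P \<pi> \<sigma> i"
  shows False
  using assms(4,5) stable_partition_succ[OF ss i] sr_instance_asym[OF sr i]
    sr_instance_trans[OF sr i]
  unfolding above_def below_def weakly_prefers_def by metis

text \<open>By \<open>long\<close>, \<open>\<pi> i\<close> strictly prefers its successor to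
  \<open>i\<close>, while \<open>\<sigma> (\<pi> i)\<close> turns out to be \<open>i\<close> or
  worse. A transposition common to both partitions violates \<open>long\<close>: both its agents are
  \<open>above\<close> and neither is \<open>below\<close>.\<close>

lemma below_succ_of_above:
  assumes sr: "sr_instance A P"
    and sp: "stable_partition A P \<pi>" and ss: "stable_partition A P \<sigma>" and i: "i \<in> A"
    and up: "above P \<pi> \<sigma> i" and long: "\<pi> (\<pi> i) \<noteq> i"
  shows "below P \<pi> \<sigma> (\<pi> i)"
proof -
  have j: "\<pi> i \<in> A" and ij: "inv \<pi> (\<pi> i) = i"
    using stable_partition_mem[OF sp i] by auto
  have succ: "(\<pi> (\<pi> i), i) \<in> P (\<pi> i)"
    using stable_partition_succ[OF sp j] long ij by simp
  show ?thesis
    using sr sp ss i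
  proof (cases rule: stable_partition_compare)
    case same
    \<comment> \<open>Both neighbours of \<open>i\<close> under \<open>\<sigma>\<close> equal
      \<open>\<pi> i\<close>, so \<open>\<sigma> (\<pi> i) = i\<close>.\<close>
    with up stable_partition_succ[OF ss i] sr_instance_asym[OF sr i]
    have "inv \<sigma> i = \<pi> i" unfolding above_def weakly_prefers_def by metis
    with succ stable_partition_mem[OF ss i] show ?thesis by (metis below_def)
  next
    case reverse
    with succ stable_partition_mem[OF ss i] show ?thesis by (metis below_def)
  next
    case low
    with not_above_below[OF sr ss i up] show ?thesis by (simp add: below_def)
  next
    case high
    from sr_instance_trans[OF sr j succ this(2)] show ?thesis by (simp add: below_def)
  qed
qed

text \<open>The edge from \<open>i\<close> only shows that \<open>\<pi> i\<close> prefers its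
  neighbours under \<open>\<sigma>\<close> to \<open>i\<close>. Ranking them against its successor
  also takes the edges of \<open>\<sigma>\<close> at \<open>\<pi> i\<close>, that is,
  \<open>stable_partition_compare\<close> with the partitions exchanged.\<close>

lemma above_succ_of_below:
  assumes sr: "sr_instance A P"
    and sp: "stable_partition A P \<pi>" and ss: "stable_partition A P \<sigma>" and i: "i \<in> A"
    and down: "below P \<pi> \<sigma> i"
  shows "above P \<pi> \<sigma> (\<pi> i)"
proof -
  define j where "j = \<pi> i"
  have j: "j \<in> A" and ij: "inv \<pi> j = i"
    using stable_partition_mem[OF sp i] by (auto simp: j_def)
  have not_above: "\<not> above P \<pi> \<sigma> i"
    using not_above_below[OF sr ss i] down by blast
  have pred: "(inv \<sigma> j, i) \<in> P j"
    using sr sp ss i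
  proof (cases rule: stable_partition_compare)
    case same
    with down sr_instance_asym[OF sr i] show ?thesis by (auto simp: below_def)
  qed (use not_above in \<open>auto simp: above_def weakly_prefers_def j_def\<close>)
  define k where "k = inv \<sigma> j"
  have k: "k \<in> A" "\<sigma> k = j" "inv \<sigma> j = k"
    using stable_partition_mem[OF ss j] by (auto simp: k_def)
  have "above P \<pi> \<sigma> j"
    using sr sp ss j
  proof (cases rule: stable_partition_compare)
    case same
    \<comment> \<open>As \<open>\<sigma> j\<close> is \<open>\<pi> j\<close>, the edge of
      \<open>\<sigma>\<close> from \<open>k\<close> into \<open>j\<close> has to decide;
      \<open>same\<close> and \<open>low\<close> on it contradict that \<open>j\<close> prefers
      \<open>k\<close> to \<open>i\<close>.\<close>
    show ?thesis
      using sr ss sp k(1)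
    proof (cases rule: stable_partition_compare)
      case same
      with k ij pred sr_instance_asym[OF sr j] show ?thesis
        using permutes_inv_eq[OF stable_partition_permutes[OF sp]] by metis
    next
      case reverse
      with k show ?thesis
        using permutes_inv_eq[OF stable_partition_permutes[OF sp]]
        by (metis above_def weakly_prefers_def)
    next
      case low
      with k ij pred sr_instance_asym[OF sr j] show ?thesis by metis
    next
      case high
      with k show ?thesis by (auto simp: above_def weakly_prefers_def)
    qed
  next
    case reverse
    then show ?thesis by (auto simp: above_def weakly_prefers_def)
  next
    case below: low
    have above_i: "(\<sigma> j, i) \<in> P j"
      using pred stable_partition_succ[OF ss j] sr_instance_trans[OF sr j] by metis
    \<comment> \<open>In the ranking of \<open>j\<close>, \<open>\<sigma> j\<close> lies strictly
      between its neighbours \<open>\<pi> j\<close> and \<open>i\<close> under \<open>\<pi>\<close>;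
      tightness of the edge from \<open>j\<close> to \<open>\<sigma> j\<close> excludes such a
      split.\<close>
    show ?thesis
      using sr ss sp j
    proof (cases rule: stable_partition_compare)
      case same
      with below sr_instance_asym[OF sr j] show ?thesis by metis
    next
      case reverse
      with above_i ij sr_instance_asym[OF sr j] show ?thesis by metis
    next
      case low
      with below sr_instance_asym[OF sr j] show ?thesis by metis
    next
      case high
      with above_i ij sr_instance_asym[OF sr j] show ?thesis by metis
    qed
  next
    case high
    then show ?thesis by (auto simp: above_def weakly_prefers_def)
  qed
  then show ?thesis by (simp add: j_def)
qed

section \<open>Agreement on odd cycles\<close>

lemma funpow_card_orbit:
  assumes "x \<in> orbit f x"
  shows "(f ^^ card (orbit f x)) x = x"
proof -
  have "card (orbit f x) = funpow_dist1 f x x"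
    using orbit_conv_funpow_dist1[OF assms] inj_on_funpow_dist1[OF assms]
    by (simp add: card_image)
  with funpow_dist1_prop[OF assms] show ?thesis by simp
qed

lemma orbit_of_swap:
  assumes "f x = y" "f y = x"
  shows "orbit f x = {x, y}"
proof
  show "orbit f x \<subseteq> {x, y}"
  proof
    fix z assume "z \<in> orbit f x"
    then show "z \<in> {x, y}" by induction (use assms in auto)
  qed
  show "{x, y} \<subseteq> orbit f x"
    using orbit.base[of f x] orbit.step[of y f x] assms by simp
qed

text \<open>Provides \<open>long\<close> in \<open>below_succ_of_above\<close> along an odd cycle:
  returning after two steps means an orbit of at most two elements, which oddness reduces to a fixed
  point.\<close>

lemma odd_orbit_no_involution:
  assumes "x \<in> orbit f x" "odd (card (orbit f x))" "f x \<noteq> x" "y \<in> orbit f x"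
  shows "f (f y) \<noteq> y"
proof
  assume "f (f y) = y"
  then have "orbit f y = {y, f y}" by (simp add: orbit_of_swap)
  moreover have "orbit f y = orbit f x"
    using assms(1,4) by (auto intro: orbit_trans orbit_swap)
  ultimately have "orbit f x = {y, f y}" "f y = y"
    using assms(2) by (auto simp: card_insert_if split: if_splits)
  with assms(1,3) show False by auto
qed

lemma stable_partition_in_orbit:
  assumes "sr_instance A P" "stable_partition A P \<pi>"
  shows "i \<in> orbit \<pi> i"
proof (rule permutation_self_in_orbit)
  have "finite A" using assms(1) by (simp add: sr_instance_def)
  with stable_partition_permutes[OF assms(2)] show "permutation \<pi>"
    unfolding permutation_permutes by blast
qed

lemma stable_partition_eq_on_odd_orbit:
  assumes sr: "sr_instance A P"
    and sp: "stable_partition A P \<pi>" and ss: "stable_partition A P \<sigma>" and i: "i \<in> A"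
    and odd: "odd (card (orbit \<pi> i))"
  shows "\<sigma> i = \<pi> i"
proof (cases "\<pi> i = i")
  case True
  \<comment> \<open>Alternation says nothing about a fixed point; there \<open>low\<close> and
    \<open>high\<close> fail because the agent ranks itself last.\<close>
  have "(\<sigma> i, i) \<in> P i" if "\<sigma> i \<noteq> i"
    using sr i stable_partition_mem(1)[OF ss i] that by (auto simp: sr_instance_def)
  then have last: "(i, \<sigma> i) \<notin> P i"
    using sr_instance_asym[OF sr i, of i "\<sigma> i"] by auto
  show ?thesis
    using sr sp ss i
  proof (cases rule: stable_partition_compare)
    case reverse
    with True have "inv \<sigma> i = i" by simp
    with True stable_partition_mem(4)[OF ss i] show ?thesis by simp
  qed (use True last in simp_all)
next
  case False
  have self: "i \<in> orbit \<pi> i" using sr sp by (rule stable_partition_in_orbit)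
  have step: "\<pi> (\<pi> y) \<noteq> y" if "y \<in> orbit \<pi> i" for y
    using odd_orbit_no_involution[OF self odd False that] .
  have not_above: "\<not> above P \<pi> \<sigma> x" if x: "x \<in> orbit \<pi> i" for x
  proof
    assume ab: "above P \<pi> \<sigma> x"
    have xA: "x \<in> A"
      using permutes_orbit_subset[OF stable_partition_permutes[OF sp] i] x by auto
    have orb: "orbit \<pi> x = orbit \<pi> i"
      using x self by (auto intro: orbit_trans orbit_swap)
    have "if even n then above P \<pi> \<sigma> ((\<pi> ^^ n) x) else below P \<pi> \<sigma> ((\<pi> ^^ n) x)" for n
    proof (induction n)
      case 0
      show ?case using ab by simp
    next
      case (Suc n)
      have "(\<pi> ^^ n) x \<in> A" "(\<pi> ^^ n) x \<in> orbit \<pi> i"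
        using xA x permutes_in_funpow_image[OF stable_partition_permutes[OF sp]] funpow_in_orbit
        by auto
      with Suc below_succ_of_above[OF sr sp ss] above_succ_of_below[OF sr sp ss] step
      show ?case by (auto split: if_splits)
    qed
    \<comment> \<open>One full turn is an odd number of steps and brings \<open>x\<close> back with
      the opposite status.\<close>
    from this[of "card (orbit \<pi> x)"] have "below P \<pi> \<sigma> x"
      using funpow_card_orbit[of x \<pi>] odd orb x by simp
    with not_above_below[OF sr ss xA ab] show False .
  qed
  have not_below: "\<not> below P \<pi> \<sigma> i"
    using above_succ_of_below[OF sr sp ss i] not_above[of "\<pi> i"] orbit.base by metis
  \<comment> \<open>\<open>reverse\<close> and \<open>high\<close> would make \<open>i\<close>
    \<open>above\<close>, \<open>low\<close> would make it \<open>below\<close>; only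
    \<open>same\<close> is left.\<close>
  show ?thesis
    using sr sp ss i
    by (cases rule: stable_partition_compare)
      (use not_above[OF self] not_below in \<open>auto simp: above_def below_def weakly_prefers_def\<close>)
qed

lemma odd_agents_subset:
  assumes sr: "sr_instance A P"
    and sp: "stable_partition A P \<pi>" and ss: "stable_partition A P \<sigma>"
  shows "odd_agents A \<pi> \<subseteq> odd_agents A \<sigma>"
proof
  fix i assume "i \<in> odd_agents A \<pi>"
  then have i: "i \<in> A" and odd: "odd (card (orbit \<pi> i))" by (auto simp: odd_agents_def)
  have self: "i \<in> orbit \<pi> i" using sr sp by (rule stable_partition_in_orbit)
  have "\<sigma> x = \<pi> x" if "x \<in> orbit \<pi> i" for x
  proof -
    have "x \<in> A" using permutes_orbit_subset[OF stable_partition_permutes[OF sp] i] that by auto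
    moreover have "orbit \<pi> x = orbit \<pi> i"
      using that self by (auto intro: orbit_trans orbit_swap)
    ultimately show ?thesis using stable_partition_eq_on_odd_orbit[OF sr sp ss] odd by simp
  qed
  then have "orbit \<sigma> i = orbit \<pi> i" by (rule orbit_cong[OF self])
  with i odd show "i \<in> odd_agents A \<sigma>" by (simp add: odd_agents_def)
qed

theorem odd_cycles_invariant:
  assumes "sr_instance A P" "stable_partition A P \<pi>" "stable_partition A P \<sigma>"
  shows "odd_agents A \<sigma> = odd_agents A \<pi>" "i \<in> odd_agents A \<pi> \<Longrightarrow> \<sigma> i = \<pi> i"
proof -
  show "odd_agents A \<sigma> = odd_agents A \<pi>"
    using odd_agents_subset[OF assms] odd_agents_subset[OF assms(1,3,2)] by (rule equalityI[rotated])
  show "\<sigma> i = \<pi> i" if "i \<in> odd_agents A \<pi>"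
    using stable_partition_eq_on_odd_orbit[OF assms] that by (simp add: odd_agents_def)
qed

section \<open>The permutation formed by the odd cycles\<close>

lemma odd_agents_closed:
  assumes "sr_instance A P" "stable_partition A P \<pi>"
  shows "\<pi> i \<in> odd_agents A \<pi> \<longleftrightarrow> i \<in> odd_agents A \<pi>"
    and "inv \<pi> i \<in> odd_agents A \<pi> \<longleftrightarrow> i \<in> odd_agents A \<pi>"
proof -
  have p: "\<pi> permutes A" using assms(2) by (rule stable_partition_permutes)
  have *: "\<pi> i \<in> odd_agents A \<pi> \<longleftrightarrow> i \<in> odd_agents A \<pi>" for i
    using self_in_orbit_step[OF stable_partition_in_orbit[OF assms, of i]] permutes_in_image[OF p]
    by (simp add: odd_agents_def)
  show "\<pi> i \<in> odd_agents A \<pi> \<longleftrightarrow> i \<in> odd_agents A \<pi>" by (rule *)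
  show "inv \<pi> i \<in> odd_agents A \<pi> \<longleftrightarrow> i \<in> odd_agents A \<pi>"
    using *[of "inv \<pi> i"] permutes_inverses[OF p] by simp
qed

lemma odd_cycles_permutes:
  assumes "sr_instance A P" "stable_partition A P \<pi>"
  shows "odd_cycles A \<pi> permutes odd_agents A \<pi>"
proof (rule bij_imp_permutes)
  have p: "\<pi> permutes A" using assms(2) by (rule stable_partition_permutes)
  show "bij_betw (odd_cycles A \<pi>) (odd_agents A \<pi>) (odd_agents A \<pi>)"
    by (rule bij_betw_byWitness[where f' = "inv \<pi>"])
      (auto simp: odd_cycles_def perm_restrict_simps odd_agents_closed[OF assms]
        permutes_inverses[OF p])
qed (simp add: odd_cycles_def perm_restrict_simps)

text \<open>Lets the predecessors in \<open>T_deletes\<close> be read as predecessors in the whole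
  partition.\<close>

lemma inv_odd_cycles:
  assumes "sr_instance A P" "stable_partition A P \<pi>" "r \<in> odd_agents A \<pi>"
  shows "inv (odd_cycles A \<pi>) r = inv \<pi> r"
  using assms odd_agents_closed[OF assms(1,2)]
    permutes_inv_eq[OF odd_cycles_permutes[OF assms(1,2)]]
    permutes_inverses[OF stable_partition_permutes[OF assms(2)]]
  by (simp add: odd_cycles_def perm_restrict_simps)

subsection \<open>Matchings as products of transpositions\<close>

lemma partner_eq:
  assumes "disjoint_pairs A M" "{i, j} \<in> M" "i \<noteq> j"
  shows "partner M i = j"
proof -
  have "k = j" if "k \<noteq> i" "{i, k} \<in> M" for k
    using assms that unfolding disjoint_pairs_def pairwise_def disjnt_def
    by (metis disjoint_iff doubleton_eq_iff insertI1)
  then have "(THE k. k \<noteq> i \<and> {i, k} \<in> M) = j" using assms by blast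
  with assms show ?thesis unfolding partner_def by auto
qed

lemma partner_edge:
  assumes "disjoint_pairs A M" "i \<in> \<Union>M"
  shows "{i, partner M i} \<in> M" "partner M i \<noteq> i"
proof -
  obtain e where "e \<in> M" "i \<in> e" using assms by auto
  then have "card e = 2" using assms(1) by (auto simp: disjoint_pairs_def)
  then obtain x y where "e = {x, y}" "x \<noteq> y" by (auto simp: card_2_iff)
  with \<open>i \<in> e\<close> obtain j where "e = {i, j}" "i \<noteq> j" by auto
  with \<open>e \<in> M\<close> partner_eq[OF assms(1), of i j]
  show "{i, partner M i} \<in> M" "partner M i \<noteq> i" by auto
qed

lemma partner_outside: "i \<notin> \<Union>M \<Longrightarrow> partner M i = i"
  unfolding partner_def by auto

lemma partner_partner:
  assumes "disjoint_pairs A M"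
  shows "partner M (partner M i) = i"
proof (cases "i \<in> \<Union>M")
  case True
  with partner_edge[OF assms True] show ?thesis
    using partner_eq[OF assms, of "partner M i" i] by (simp add: insert_commute)
qed (simp add: partner_outside)

lemma partner_permutes:
  assumes "disjoint_pairs A M" "\<Union>M \<subseteq> B"
  shows "partner M permutes B"
  unfolding permutes_def using partner_partner[OF assms(1)] partner_outside assms(2)
  by (metis subsetD)

section \<open>Perfect stable matchings and reduced stable partitions\<close>

theorem theorem19:
  fixes A :: "'a set" and P :: "'a \<Rightarrow> 'a rel" and \<pi> :: "'a \<Rightarrow> 'a" and M :: "'a set set"
  assumes "sr_instance A P"
    and "stable_partition A P \<pi>"
    and "disjoint_pairs A M"
  shows "perfect_stable_matching (A - odd_agents A \<pi>)
           (T_prefs A P (odd_agents A \<pi>) (odd_cycles A \<pi>)) M \<longleftrightarrow>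
         stable_partition A P (partner M \<circ> odd_cycles A \<pi>) \<and>
         reduced A (partner M \<circ> odd_cycles A \<pi>)"
proof -
  define C where "C = odd_agents A \<pi>"
  define \<omega> where "\<omega> = odd_cycles A \<pi>"
  define \<sigma> where "\<sigma> = partner M \<circ> \<omega>"
  define T where "T = T_prefs A P C \<omega>"
  note sr = assms(1) and sp = assms(2) and M = assms(3)
  note pp = stable_partition_permutes[OF sp]
  have CA: "C \<subseteq> A" by (auto simp: C_def odd_agents_def)
  have \<omega>: "\<omega> permutes C" unfolding \<omega>_def C_def by (rule odd_cycles_permutes[OF sr sp])
  have \<omega>_in: "\<omega> i = \<pi> i" if "i \<in> C" for i
    using that by (simp add: \<omega>_def C_def odd_cycles_def perm_restrict_simps)
  have inv\<omega>: "inv \<omega> i = inv \<pi> i" if "i \<in> C" for i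
    using inv_odd_cycles[OF sr sp] that by (simp add: \<omega>_def C_def)
  have closed: "\<pi> i \<in> C \<longleftrightarrow> i \<in> C" "inv \<pi> i \<in> C \<longleftrightarrow> i \<in> C" for i
    using odd_agents_closed[OF sr sp] by (simp_all add: C_def)
  have T: "(x, y) \<in> T i \<longleftrightarrow> (x, y) \<in> P i \<and> {x, y} \<subseteq> A - C \<and>
      \<not> T_unacceptable P C \<omega> i x \<and> \<not> T_unacceptable P C \<omega> i y" for x y i
    by (auto simp: T_def T_prefs_def E_prefs_def)
  have shape: "\<sigma> i = \<pi> i" "inv \<sigma> i = inv \<pi> i" if "\<Union>M = A - C" "i \<in> C" for i
  proof -
    have fix_C: "partner M x = x" if "x \<in> C" for x
      by (rule partner_outside) (use that \<open>\<Union>M = A - C\<close> in auto)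
    have *: "\<sigma> x = \<pi> x" if "x \<in> C" for x
      using that fix_C[of "\<pi> x"] closed \<omega>_in by (simp add: \<sigma>_def)
    have "\<sigma> permutes A"
      unfolding \<sigma>_def using permutes_compose[OF permutes_subset[OF \<omega> CA] partner_permutes[OF M]]
        that(1) by auto
    with *[of "inv \<pi> i"] *[of i] that closed permutes_inverses[OF pp]
    show "\<sigma> i = \<pi> i" "inv \<sigma> i = inv \<pi> i" by (simp_all add: permutes_inv_eq)
  qed
  have outside: "\<sigma> i = partner M i" if "i \<notin> C" for i
    using \<omega> that by (simp add: \<sigma>_def permutes_not_in)
  \<comment> \<open>With the partner outside \<open>C\<close> as well, \<open>\<omega>\<close> fixes
    it, and \<open>\<sigma>\<close> acts as the involution \<open>partner M\<close>.\<close>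
  have outside_inv: "inv \<sigma> i = partner M i" if "\<sigma> permutes A" "i \<notin> C" "partner M i \<notin> C" for i
    using that outside[of "partner M i"] partner_partner[OF M] by (simp add: permutes_inv_eq)
  have "perfect_stable_matching (A - C) T M \<longleftrightarrow> stable_partition A P \<sigma> \<and> reduced A \<sigma>"
  proof
    assume perf: "perfect_stable_matching (A - C) T M"
    then have U: "\<Union>M = A - C" and mat: "matching (A - C) T M"
      and nb: "\<And>i j. \<not> blocking_pair (A - C) T M i j"
      by (auto simp: perfect_stable_matching_def stable_matching_def)
    have \<sigma>: "\<sigma> permutes A"
      unfolding \<sigma>_def using permutes_compose[OF permutes_subset[OF \<omega> CA] partner_permutes[OF M]] U
      by auto
    have edge: "{i, partner M i} \<in> M" "partner M i \<noteq> i" "partner M i \<in> A - C"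
      if "i \<in> A - C" for i
      using partner_edge[OF M, of i] that U by blast+
    have acc: "(partner M i, i) \<in> T i" if "i \<in> A - C" for i
      using mat edge[OF that] unfolding matching_def acceptable_def by metis
    have inv_out: "inv \<sigma> i = partner M i" if "i \<in> A - C" for i
      using outside_inv[OF \<sigma>] edge[OF that] that by auto
    have nd: "\<not> T_deletes P C \<omega> i (partner M i)" if "i \<in> A - C" for i
      using acc[OF that] edge[OF that] by (auto simp: T T_unacceptable_def)
    \<comment> \<open>Such a blocking pair is exactly a reason to delete the matched pair of
      \<open>i\<close>.\<close>
    have mixed: "(r, inv \<sigma> i) \<notin> P i \<or> (i, inv \<sigma> r) \<notin> P r" if "i \<in> A - C" "r \<in> C" for i r
      using nd[OF that(1)] that inv_out shape(2)[OF U] inv\<omega> by (auto simp: T_deletes_def)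
    have out: "(j, inv \<sigma> i) \<notin> P i \<or> (i, inv \<sigma> j) \<notin> P j"
      if i: "i \<in> A - C" and j: "j \<in> A - C" and "i \<noteq> j" for i j
    proof (rule ccontr)
      assume "\<not> ?thesis"
      then have b: "(j, partner M i) \<in> P i" "(i, partner M j) \<in> P j"
        using inv_out i j by auto
      \<comment> \<open>If \<open>r\<close> beats \<open>y\<close> for \<open>x\<close> and
        \<open>y\<close> beats the partner, then \<open>r\<close> beats the partner. So a deletion
        of the blocking pair would also delete a matched pair; hence the blocking pair survives in
        \<open>T\<close>.\<close>
      have nd': "\<not> T_deletes P C \<omega> x y"
        if "x \<in> A - C" "(y, partner M x) \<in> P x" for x y
        using nd[OF that(1)] that sr_instance_trans[OF sr, of x] unfolding T_deletes_def by blast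
      have un: "\<not> T_unacceptable P C \<omega> i j" "\<not> T_unacceptable P C \<omega> j i"
        using nd' b i j by (auto simp: T_unacceptable_def)
      have "(j, i) \<in> P i" "(i, j) \<in> P j" using sr i j \<open>i \<noteq> j\<close> by (auto simp: sr_instance_def)
      then have "blocking_pair (A - C) T M i j"
        using i j \<open>i \<noteq> j\<close> b un acc[OF i] acc[OF j]
        by (auto simp: blocking_pair_def acceptable_def T)
      with nb show False by blast
    qed
    have "stable_partition A P \<sigma>"
      unfolding stable_partition_def
    proof (intro conjI ballI notI)
      show "\<sigma> permutes A" by (rule \<sigma>)
      show "\<sigma> i = inv \<sigma> i \<or> (\<sigma> i, inv \<sigma> i) \<in> P i" if "i \<in> A" for i
        using that stable_partition_succ[OF sp] shape[OF U] outside inv_out by (cases "i \<in> C") auto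
      assume "\<exists>i\<in>A. \<exists>j\<in>A. i \<noteq> j \<and> (j, inv \<sigma> i) \<in> P i \<and> (i, inv \<sigma> j) \<in> P j"
      then obtain i j where ij: "i \<in> A" "j \<in> A" "i \<noteq> j"
        "(j, inv \<sigma> i) \<in> P i" "(i, inv \<sigma> j) \<in> P j" by blast
      show False
      proof (cases "i \<in> C"; cases "j \<in> C")
        assume "i \<in> C" "j \<in> C"
        then show False
          using stable_partition_no_block[OF sp ij(1,2,3)] ij(4,5) shape(2)[OF U] by simp
      qed (use ij mixed out in blast)+
    qed
    moreover have "reduced A \<sigma>"
      unfolding reduced_def
    proof
      fix i assume i: "i \<in> A"
      show "card (orbit \<sigma> i) = 2 \<or> odd (card (orbit \<sigma> i))"
      proof (cases "i \<in> C")
        case True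
        have self: "i \<in> orbit \<pi> i" using sr sp by (rule stable_partition_in_orbit)
        have "x \<in> C" if "x \<in> orbit \<pi> i" for x
          using that by induction (use True closed in auto)
        then have "orbit \<sigma> i = orbit \<pi> i"
          using shape(1)[OF U] by (intro orbit_cong[OF self]) auto
        with True show ?thesis by (simp add: C_def odd_agents_def)
      next
        case False
        with i edge[of i] partner_partner[OF M] outside show ?thesis
          using orbit_of_swap[of \<sigma> i "partner M i"] by (simp add: card_insert_if)
      qed
    qed
    ultimately show "stable_partition A P \<sigma> \<and> reduced A \<sigma>" ..
  next
    assume "stable_partition A P \<sigma> \<and> reduced A \<sigma>"
    then have ss: "stable_partition A P \<sigma>" by simp
    note \<sigma> = stable_partition_permutes[OF ss]
    have C\<sigma>: "odd_agents A \<sigma> = C"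
      using odd_cycles_invariant(1)[OF sr sp ss] by (simp add: C_def)
    \<comment> \<open>\<open>M\<close> might touch the odd cycles. By invariance
      \<open>\<sigma>\<close> sends \<open>inv \<pi> x\<close> to \<open>x\<close>, and by
      construction to \<open>partner M x\<close>.\<close>
    have fix_C: "partner M x = x" if x: "x \<in> C" for x
    proof -
      have y: "inv \<pi> x \<in> C" using x closed by simp
      then have "\<sigma> (inv \<pi> x) = x"
        using odd_cycles_invariant(2)[OF sr sp ss] permutes_inverses[OF pp] by (simp add: C_def)
      with y show ?thesis
        using \<omega>_in permutes_inverses[OF pp] by (simp add: \<sigma>_def)
    qed
    \<comment> \<open>An unmatched agent outside \<open>C\<close> would be a fixed point of
      \<open>\<sigma>\<close>, hence a new odd cycle.\<close>
    have "i \<in> \<Union>M" if "i \<in> A - C" for i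
    proof (rule ccontr)
      assume "i \<notin> \<Union>M"
      then have "orbit \<sigma> i = {i}"
        using outside[of i] that by (simp add: partner_outside orbit_eq_singleton_iff)
      with that C\<sigma> show False by (auto simp: odd_agents_def)
    qed
    moreover have "\<Union>M \<subseteq> A" using M by (auto simp: disjoint_pairs_def)
    ultimately have U: "\<Union>M = A - C"
      using fix_C partner_edge(2)[OF M] by blast
    have inv_out: "inv \<sigma> i = partner M i" if "i \<in> A - C" for i
      using that outside_inv[OF \<sigma>, of i] fix_C[of "partner M i"] partner_partner[OF M, of i]
      by force
    \<comment> \<open>The agent \<open>r\<close> responsible for deleting a matched pair would block
      \<open>\<sigma>\<close> together with \<open>i\<close>.\<close>
    have nd: "\<not> T_deletes P C \<omega> i (partner M i)" if i: "i \<in> A - C" for i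
    proof
      assume "T_deletes P C \<omega> i (partner M i)"
      then obtain r where "r \<in> C" "(i, inv \<sigma> r) \<in> P r" "(r, inv \<sigma> i) \<in> P i"
        using inv_out[OF i] shape(2)[OF U] inv\<omega> by (auto simp: T_deletes_def)
      with i CA show False using stable_partition_no_block[OF ss, of i r] by blast
    qed
    have mat: "matching (A - C) T M"
      unfolding matching_def
    proof (intro conjI allI impI)
      show "disjoint_pairs (A - C) M"
        using M U by (auto simp: disjoint_pairs_def)
      fix i j assume ij: "i \<noteq> j \<and> {i, j} \<in> M"
      then have p: "partner M i = j" "partner M j = i" and mem: "i \<in> A - C" "j \<in> A - C"
        using partner_eq[OF M, of i j] partner_eq[OF M, of j i] U
        by (auto simp: insert_commute)
      with nd[of i] nd[of j] have "\<not> T_unacceptable P C \<omega> i j" "\<not> T_unacceptable P C \<omega> j i"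
        by (auto simp: T_unacceptable_def)
      moreover have "(j, i) \<in> P i" "(i, j) \<in> P j"
        using sr ij mem by (auto simp: sr_instance_def)
      ultimately show "acceptable T i j" "acceptable T j i"
        using mem by (auto simp: acceptable_def T T_unacceptable_def)
    qed
    \<comment> \<open>Preferences in \<open>T\<close> are preferences in \<open>P\<close>, and
      partners are predecessors under \<open>\<sigma>\<close>, so the pair would block
      \<open>\<sigma>\<close>.\<close>
    have "\<not> blocking_pair (A - C) T M i j" for i j
      using stable_partition_no_block[OF ss, of i j] inv_out[of i] inv_out[of j]
      by (auto simp: blocking_pair_def T)
    with mat U show "perfect_stable_matching (A - C) T M"
      by (simp add: perfect_stable_matching_def stable_matching_def)
  qed
  then show ?thesis by (simp add: C_def \<omega>_def \<sigma>_def T_def)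
qed

end
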